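(* Let $\mathcal{K}=(\mathcal{T},\mathcal{A})$ be an $\mathcal{ALC}+\mathbf{T}^+$ knowledge base with typicality operators $\mathbf{T}_1,\dots,\mathbf{T}_k$, let $\mathcal{L}_{\mathbf{T}_1},\dots,\mathcal{L}_{\mathbf{T}_k}$ be finite sets of concept names, let $\Sigma$ be a signature with $\mathsf{sig}(\mathcal{K})\subseteq\Sigma$, and let $\mathsf{Circ}_{\mathsf{CP}}(\mathcal{T}',\mathcal{A}')$ be the corresponding circumscribed knowledge base and $\varphi$ the mapping from $\mathcal{ALC}+\mathbf{T}^+$ interpretations to $\mathcal{ALC}$ interpretations, both defined in the context. Let $\mathcal{I}$ be an $\mathcal{ALC}+\mathbf{T}^+$ interpretation, and let $\mathcal{J}$ be an $\mathcal{ALC}$ interpretation such that each $(r_i^{\mathcal{J}})^{-1}$ ($1\le i\le k$) is irreflexive, transitive and satisfies the Smoothness Condition. Then: (a) $\mathcal{I}$ is a minimal model of $\mathcal{K}$ with respect to $\mathcal{L}_{\mathbf{T}_1},\dots,\mathcal{L}_{\mathbf{T}_k}$ if and only if $\varphi(\mathcal{I})\models\mathsf{Circ}_{\mathsf{CP}}(\mathcal{T}',\mathcal{A}')$; (b) $\mathcal{J}\models\mathsf{Circ}_{\mathsf{CP}}(\mathcal{T}',\mathcal{A}')$ if and only if $\mathcal{J}$ is in the image of $\varphi$ and $\varphi^{-1}(\mathcal{J})$ is a minimal model of $\mathcal{K}$ with respect to $\mathcal{L}_{\mathbf{T}_1},\dots,\mathcal{L}_{\mathbf{T}_k}$.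
   Context: Logic. $\mathsf{N_C},\mathsf{N_R},\mathsf{N_I}$: countable sets of concept, role and individual names. Classical concepts: $C ::= A \mid \neg C \mid C\sqcap D \mid \exists r.C$. Extended concepts: $C_e ::= C \mid \mathbf{T}_i(A) \mid \neg C_e \mid C_e\sqcap D_e$ ($A\in\mathsf{N_C}$, $1\le i\le k$). Knowledge base $\mathcal{K}=(\mathcal{T},\mathcal{A})$: $\mathcal{T}$ is a finite set of $C\sqsubseteq D$ with $C$ classical or of the form $\mathbf{T}_i(A)$ and $D$ classical; $\mathcal{A}$ is a finite set of assertions $C_e(a)$, $r(a,b)$. An $\mathcal{ALC}+\mathbf{T}^+$ interpretation is $\mathcal{I}=(\Delta^{\mathcal{I}},\cdot^{\mathcal{I}},<_1,\dots,<_k)$, an $\mathcal{ALC}$ interpretation with irreflexive transitive relations $<_i$ on $\Delta^{\mathcal{I}}$ satisfying the Smoothness Condition: for all $S\subseteq\Delta^{\mathcal{I}}$, $x\in S$, either $x\in\mathsf{Min}_{<_i}(S)$ or some $y\in\mathsf{Min}_{<_i}(S)$ has $y<_i x$, where $\mathsf{Min}_{<_i}(S)=\{x\in S\mid \nexists y\in S: y<_i x\}$. $[\mathbf{T}_i(A)]^{\mathcal{I}}=\mathsf{Min}_{<_i}(A^{\mathcal{I}})$; the other constructors are as in $\mathcal{ALC}$. $(\neg\Box_i\neg A)^{\mathcal{I}}=\{x\mid\exists y<_i x,\ y\in A^{\mathcal{I}}\}$. Minimal models. $\mathcal{I}^{\Box^-}_{i}=\{(x,\neg\Box_i\neg A)\mid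 x\in(\neg\Box_i\neg A)^{\mathcal{I}},\ A\in\mathcal{L}_{\mathbf{T}_i}\}$. $\mathcal{I}$ is preferred to $\mathcal{J}$ iff they have the same domain, interpret all individual names identically, $\mathcal{I}^{\Box^-}_{i}\subseteq\mathcal{J}^{\Box^-}_{i}$ for all $i$, with strict inclusion for some $i$. $\mathcal{I}$ is a minimal model of $\mathcal{K}$ iff $\mathcal{I}\models\mathcal{K}$ and no model of $\mathcal{K}$ is preferred to $\mathcal{I}$. Circumscription. $\mathsf{Circ}_{\mathsf{CP}}(\mathcal{T}',\mathcal{A}')$ with $\mathsf{CP}=(M,F,V)$, where $M,F,V$ partition the predicates used ($M$ minimized, $F$ fixed, $V$ varying). $\mathcal{I}<_{\mathsf{CP}}\mathcal{J}$ iff same domain, same interpretation of individual names, $A^{\mathcal{I}}=A^{\mathcal{J}}$ for $A\in F$, $A^{\mathcal{I}}\subseteq A^{\mathcal{J}}$ for all $A\in M$ and strict inclusion for some $A\in M$. $\mathcal{I}\models\mathsf{Circ}_{\mathsf{CP}}(\mathcal{T}',\mathcal{A}')$ iff $\mathcal{I}$ is a model of $(\mathcal{T}',\mathcal{A}')$ and there is no model $\mathcal{I}'$ of $(\mathcal{T}',\mathcal{A}')$ with $\mathcal{I}'<_{\mathsf{CP}}\mathcal{I}$. Signatures. A signature $\Sigma$ is a finite set of concept names, role names and concepts of the form $\mathbf{T}_i(A)$; $\Sigma|_{\mathcal{ALC}}$ is $\Sigma$ without the concepts $\mathbf{T}_i(A)$. $\mathsf{sig}(\mathcal{K})$ is the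 set of all such symbols occurring in $\mathcal{K}$. It is assumed that $A\in\Sigma$ whenever $\mathbf{T}_i(A)\in\Sigma$ or $A\in\mathcal{L}_{\mathbf{T}_i}$. Translation of $\mathcal{K}$ to $\mathcal{K}'=(\mathcal{T}',\mathcal{A}')$. For each $i$ and each $A$ with $A\in\mathcal{L}_{\mathbf{T}_i}$ or $\mathbf{T}_i(A)\in\Sigma$, introduce a fresh concept name $A_i^*$; for each $i$ a fresh role name $r_i$. For a concept $C$ over $\Sigma$, $\bar C$ is obtained by replacing every $\mathbf{T}_i(A)$ by $(A\sqcap\neg A_i^* )$. $\mathcal{T}'$ consists of $\bar C\sqsubseteq\bar D$ for all $C\sqsubseteq D\in\mathcal{T}$ and, for each introduced $A_i^*$, of $A_i^*\equiv\exists r_i.(A\sqcap\neg A_i^* )$ and $\exists r_i.A_i^*\sqsubseteq A_i^*$. $\mathcal{A}'$ is obtained from $\mathcal{A}$ by replacing each $C(a)$ by $\bar C(a)$ (role assertions are kept). $\mathsf{CP}=(M,F,V)$ with $M=\{A_j^*\mid 1\le j\le k,\ A\in\mathcal{L}_{\mathbf{T}_j}\}$, $F=\emptyset$, $V=\Sigma|_{\mathcal{ALC}}\cup\{A_i^*\mid A_i^*\notin M\}\cup\{r_i\mid 1\le i\le k\}$. Mapping $\varphi$. $\varphi(\mathcal{I})=\mathcal{J}$ iff $\Delta^{\mathcal{J}}=\Delta^{\mathcal{I}}$; $X^{\mathcal{J}}=X^{\mathcal{I}}$ for $X\in\Sigma|_{\mathcal{ALC}}$; $(A_i^* )^{\mathcal{J}}=(\neg\Box_i\neg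 A)^{\mathcal{I}}$ for each introduced $A_i^*$; $r_i^{\mathcal{J}}=(<_i)^{-1}$ for $1\le i\le k$; $a^{\mathcal{J}}=a^{\mathcal{I}}$ for all $a\in\mathsf{N_I}$. Convention: interpretations are considered only with respect to the symbols of $\Sigma$ (for $\mathcal{ALC}+\mathbf{T}^+$, together with $<_1,\dots,<_k$) and of $\Sigma|_{\mathcal{ALC}}\cup\{A_i^*\}\cup\{r_i\}$ (for $\mathcal{ALC}$), besides domain and individual names; two interpretations agreeing on these are identified. With this convention $\varphi$ is injective, and $\varphi^{-1}$ denotes its inverse on its image. *)

theory Defs
  imports "HOL-Library.Countable"
begin

datatype ('c, 'r) concept =
    Atom 'c
  | Neg "('c, 'r) concept"
  | Conj "('c, 'r) concept" "('c, 'r) concept"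
  | Exist 'r "('c, 'r) concept"

datatype ('c, 'r) econcept =
    Classical "('c, 'r) concept"
  | Typ nat 'c
  | ENeg "('c, 'r) econcept"
  | EConj "('c, 'r) econcept" "('c, 'r) econcept"

datatype ('c, 'r) tinclusion =
    Incl "('c, 'r) concept" "('c, 'r) concept"
  | TypIncl nat 'c "('c, 'r) concept"

text \<open>The parameter \<open>'x\<close> is the type of concepts allowed in concept assertions:
  extended concepts for the typicality logic, classical concepts for plain ALC.\<close>

datatype ('x, 'r, 'n) assertion =
    ConceptAssn 'x 'n
  | RoleAssn 'r 'n 'n

type_synonym ('c, 'r, 'n) tkb =
  "('c, 'r) tinclusion set \<times> (('c, 'r) econcept, 'r, 'n) assertion set"

type_synonym ('c, 'r, 'n) alc_kb =
  "(('c, 'r) concept \<times> ('c, 'r) concept) set \<times> (('c, 'r) concept, 'r, 'n) assertion set"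

datatype ('c, 'r) predicate = PC 'c | PR 'r

datatype ('c, 'r) symbol = Pred "('c, 'r) predicate" | TypSym nat 'c

fun sig_concept :: "('c, 'r) concept \<Rightarrow> ('c, 'r) symbol set" where
  "sig_concept (Atom A) = {Pred (PC A)}"
| "sig_concept (Neg C) = sig_concept C"
| "sig_concept (Conj C D) = sig_concept C \<union> sig_concept D"
| "sig_concept (Exist r C) = insert (Pred (PR r)) (sig_concept C)"

fun sig_econcept :: "('c, 'r) econcept \<Rightarrow> ('c, 'r) symbol set" where
  "sig_econcept (Classical C) = sig_concept C"
| "sig_econcept (Typ i A) = {TypSym i A, Pred (PC A)}"
| "sig_econcept (ENeg C) = sig_econcept C"
| "sig_econcept (EConj C D) = sig_econcept C \<union> sig_econcept D"

fun sig_tinclusion :: "('c, 'r) tinclusion \<Rightarrow> ('c, 'r) symbol set" where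
  "sig_tinclusion (Incl C D) = sig_concept C \<union> sig_concept D"
| "sig_tinclusion (TypIncl i A D) = {TypSym i A, Pred (PC A)} \<union> sig_concept D"

fun sig_assertion :: "(('c, 'r) econcept, 'r, 'n) assertion \<Rightarrow> ('c, 'r) symbol set" where
  "sig_assertion (ConceptAssn C a) = sig_econcept C"
| "sig_assertion (RoleAssn r a b) = {Pred (PR r)}"

definition sig :: "('c, 'r, 'n) tkb \<Rightarrow> ('c, 'r) symbol set" where
  "sig K = (\<Union>ax\<in>fst K. sig_tinclusion ax) \<union> (\<Union>as\<in>snd K. sig_assertion as)"

text \<open>The operators are \<open>T\<^sub>1, \<dots>, T\<^sub>k\<close>, so an index occurring in a
  knowledge base or a signature has to lie in \<open>{1..k}\<close>.\<close>

definition is_tkb :: "nat \<Rightarrow> ('c, 'r, 'n) tkb \<Rightarrow> bool" where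
  "is_tkb k K \<longleftrightarrow> finite (fst K) \<and> finite (snd K) \<and>
     (\<forall>i A. TypSym i A \<in> sig K \<longrightarrow> i \<in> {1..k})"

definition is_signature :: "nat \<Rightarrow> (nat \<Rightarrow> 'c set) \<Rightarrow> ('c, 'r) symbol set \<Rightarrow> bool" where
  "is_signature k L \<Sigma> \<longleftrightarrow> finite \<Sigma> \<and>
     (\<forall>i A. TypSym i A \<in> \<Sigma> \<longrightarrow> i \<in> {1..k} \<and> Pred (PC A) \<in> \<Sigma>) \<and>
     (\<forall>i\<in>{1..k}. \<forall>A\<in>L i. Pred (PC A) \<in> \<Sigma>)"

definition alc_part :: "('c, 'r) symbol set \<Rightarrow> ('c, 'r) predicate set" where
  "alc_part \<Sigma> = {p. Pred p \<in> \<Sigma>}"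

text \<open>Domains are nonempty subsets of a type \<open>'d\<close>. A pair \<open>(y, x) \<in> lt I i\<close>
  stands for \<open>y <\<^sub>i x\<close>.\<close>

record ('d, 'c, 'r, 'n) interp =
  Delta :: "'d set"
  conc :: "'c \<Rightarrow> 'd set"
  role :: "'r \<Rightarrow> ('d \<times> 'd) set"
  ind :: "'n \<Rightarrow> 'd"

record ('d, 'c, 'r, 'n) tinterp = "('d, 'c, 'r, 'n) interp" +
  lt :: "nat \<Rightarrow> ('d \<times> 'd) set"

text \<open>Interpretations are considered only with respect to a vocabulary \<open>P\<close> (and, for
  the typicality logic, \<open>lt I 1, \<dots>, lt I k\<close>), and those agreeing on it are
  identified. Each class of identified interpretations is represented by its unique
  member in which everything outside the vocabulary is empty.\<close>

definition is_interp ::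
  "('c, 'r) predicate set \<Rightarrow> ('d, 'c, 'r, 'n, 'z) interp_scheme \<Rightarrow> bool" where
  "is_interp P I \<longleftrightarrow> Delta I \<noteq> {} \<and>
     (\<forall>A. conc I A \<subseteq> Delta I) \<and>
     (\<forall>r. role I r \<subseteq> Delta I \<times> Delta I) \<and>
     (\<forall>a. ind I a \<in> Delta I) \<and>
     (\<forall>A. PC A \<notin> P \<longrightarrow> conc I A = {}) \<and>
     (\<forall>r. PR r \<notin> P \<longrightarrow> role I r = {})"

definition min_elems :: "('d \<times> 'd) set \<Rightarrow> 'd set \<Rightarrow> 'd set" where
  "min_elems R S = {x \<in> S. \<not> (\<exists>y\<in>S. (y, x) \<in> R)}"

definition smooth_on :: "'d set \<Rightarrow> ('d \<times> 'd) set \<Rightarrow> bool" where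
  "smooth_on D R \<longleftrightarrow>
     (\<forall>S\<subseteq>D. \<forall>x\<in>S. x \<in> min_elems R S \<or> (\<exists>y\<in>min_elems R S. (y, x) \<in> R))"

definition is_tinterp ::
  "nat \<Rightarrow> ('c, 'r) symbol set \<Rightarrow> ('d, 'c, 'r, 'n) tinterp \<Rightarrow> bool" where
  "is_tinterp k \<Sigma> I \<longleftrightarrow> is_interp (alc_part \<Sigma>) I \<and>
     (\<forall>i\<in>{1..k}. lt I i \<subseteq> Delta I \<times> Delta I \<and>
        irrefl (lt I i) \<and> trans (lt I i) \<and> smooth_on (Delta I) (lt I i)) \<and>
     (\<forall>i. i \<notin> {1..k} \<longrightarrow> lt I i = {})"

fun sem :: "('d, 'c, 'r, 'n, 'z) interp_scheme \<Rightarrow> ('c, 'r) concept \<Rightarrow> 'd set" where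
  "sem I (Atom A) = conc I A"
| "sem I (Neg C) = Delta I - sem I C"
| "sem I (Conj C D) = sem I C \<inter> sem I D"
| "sem I (Exist r C) = {x \<in> Delta I. \<exists>y. (x, y) \<in> role I r \<and> y \<in> sem I C}"

fun esem :: "('d, 'c, 'r, 'n) tinterp \<Rightarrow> ('c, 'r) econcept \<Rightarrow> 'd set" where
  "esem I (Classical C) = sem I C"
| "esem I (Typ i A) = min_elems (lt I i) (conc I A)"
| "esem I (ENeg C) = Delta I - esem I C"
| "esem I (EConj C D) = esem I C \<inter> esem I D"

fun sat_tinclusion :: "('d, 'c, 'r, 'n) tinterp \<Rightarrow> ('c, 'r) tinclusion \<Rightarrow> bool" where
  "sat_tinclusion I (Incl C D) \<longleftrightarrow> sem I C \<subseteq> sem I D"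
| "sat_tinclusion I (TypIncl i A D) \<longleftrightarrow> esem I (Typ i A) \<subseteq> sem I D"

fun sat_tassertion ::
  "('d, 'c, 'r, 'n) tinterp \<Rightarrow> (('c, 'r) econcept, 'r, 'n) assertion \<Rightarrow> bool" where
  "sat_tassertion I (ConceptAssn C a) \<longleftrightarrow> ind I a \<in> esem I C"
| "sat_tassertion I (RoleAssn r a b) \<longleftrightarrow> (ind I a, ind I b) \<in> role I r"

definition tmodel ::
  "nat \<Rightarrow> ('c, 'r) symbol set \<Rightarrow> ('c, 'r, 'n) tkb \<Rightarrow> ('d, 'c, 'r, 'n) tinterp \<Rightarrow> bool" where
  "tmodel k \<Sigma> K I \<longleftrightarrow> is_tinterp k \<Sigma> I \<and>
     (\<forall>ax\<in>fst K. sat_tinclusion I ax) \<and> (\<forall>as\<in>snd K. sat_tassertion I as)"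

fun sat_assertion ::
  "('d, 'c, 'r, 'n) interp \<Rightarrow> (('c, 'r) concept, 'r, 'n) assertion \<Rightarrow> bool" where
  "sat_assertion J (ConceptAssn C a) \<longleftrightarrow> ind J a \<in> sem J C"
| "sat_assertion J (RoleAssn r a b) \<longleftrightarrow> (ind J a, ind J b) \<in> role J r"

definition alc_model ::
  "('c, 'r) predicate set \<Rightarrow> ('c, 'r, 'n) alc_kb \<Rightarrow> ('d, 'c, 'r, 'n) interp \<Rightarrow> bool" where
  "alc_model P K J \<longleftrightarrow> is_interp P J \<and>
     (\<forall>(C, D)\<in>fst K. sem J C \<subseteq> sem J D) \<and> (\<forall>as\<in>snd K. sat_assertion J as)"

text \<open>The concepts \<open>\<not>\<box>\<^sub>i\<not>A\<close> are not part of the syntax; only their extension,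
  given by \<open>not_box_not I i A\<close>, is needed.\<close>

definition not_box_not :: "('d, 'c, 'r, 'n) tinterp \<Rightarrow> nat \<Rightarrow> 'c \<Rightarrow> 'd set" where
  "not_box_not I i A = {x \<in> Delta I. \<exists>y. (y, x) \<in> lt I i \<and> y \<in> conc I A}"

text \<open>For fixed \<open>i\<close>, the pair \<open>(x, \<not>\<box>\<^sub>i\<not>A)\<close> is represented by \<open>(x, A)\<close>.\<close>

definition box_minus ::
  "(nat \<Rightarrow> 'c set) \<Rightarrow> ('d, 'c, 'r, 'n) tinterp \<Rightarrow> nat \<Rightarrow> ('d \<times> 'c) set" where
  "box_minus L I i = {(x, A). x \<in> not_box_not I i A \<and> A \<in> L i}"

definition preferred ::
  "nat \<Rightarrow> (nat \<Rightarrow> 'c set) \<Rightarrow> ('d, 'c, 'r, 'n) tinterp \<Rightarrow> ('d, 'c, 'r, 'n) tinterp \<Rightarrow> bool" where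
  "preferred k L I J \<longleftrightarrow> Delta I = Delta J \<and> ind I = ind J \<and>
     (\<forall>i\<in>{1..k}. box_minus L I i \<subseteq> box_minus L J i) \<and>
     (\<exists>i\<in>{1..k}. box_minus L I i \<subset> box_minus L J i)"

definition minimal_model ::
  "nat \<Rightarrow> (nat \<Rightarrow> 'c set) \<Rightarrow> ('c, 'r) symbol set \<Rightarrow> ('c, 'r, 'n) tkb \<Rightarrow>
    ('d, 'c, 'r, 'n) tinterp \<Rightarrow> bool" where
  "minimal_model k L \<Sigma> K I \<longleftrightarrow>
     tmodel k \<Sigma> K I \<and> \<not> (\<exists>I'. tmodel k \<Sigma> K I' \<and> preferred k L I' I)"

type_synonym ('c, 'r) circ_pattern =
  "('c, 'r) predicate set \<times> ('c, 'r) predicate set \<times> ('c, 'r) predicate set"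

fun pred_sub ::
  "('d, 'c, 'r, 'n) interp \<Rightarrow> ('d, 'c, 'r, 'n) interp \<Rightarrow> ('c, 'r) predicate \<Rightarrow> bool" where
  "pred_sub I J (PC A) \<longleftrightarrow> conc I A \<subseteq> conc J A"
| "pred_sub I J (PR r) \<longleftrightarrow> role I r \<subseteq> role J r"

definition circ_less ::
  "('c, 'r) circ_pattern \<Rightarrow> ('d, 'c, 'r, 'n) interp \<Rightarrow> ('d, 'c, 'r, 'n) interp \<Rightarrow> bool" where
  "circ_less CP I J \<longleftrightarrow> (case CP of (M, F, V) \<Rightarrow>
     Delta I = Delta J \<and> ind I = ind J \<and>
     (\<forall>p\<in>F. pred_sub I J p \<and> pred_sub J I p) \<and>
     (\<forall>p\<in>M. pred_sub I J p) \<and>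
     (\<exists>p\<in>M. pred_sub I J p \<and> \<not> pred_sub J I p))"

definition circ_vocab :: "('c, 'r) circ_pattern \<Rightarrow> ('c, 'r) predicate set" where
  "circ_vocab CP = (case CP of (M, F, V) \<Rightarrow> M \<union> F \<union> V)"

definition circ_model ::
  "('c, 'r) circ_pattern \<Rightarrow> ('c, 'r, 'n) alc_kb \<Rightarrow> ('d, 'c, 'r, 'n) interp \<Rightarrow> bool" where
  "circ_model CP K J \<longleftrightarrow> alc_model (circ_vocab CP) K J \<and>
     \<not> (\<exists>J'. alc_model (circ_vocab CP) K J' \<and> circ_less CP J' J)"

text \<open>The fresh names are given by functions \<open>st\<close> and \<open>rr\<close>: \<open>st i A\<close> is
  \<open>A\<^sub>i\<^sup>*\<close> and \<open>rr i\<close> is \<open>r\<^sub>i\<close>. Only their values on \<open>introduced k L \<Sigma>\<close>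
  and on \<open>{1..k}\<close> matter.\<close>

definition introduced ::
  "nat \<Rightarrow> (nat \<Rightarrow> 'c set) \<Rightarrow> ('c, 'r) symbol set \<Rightarrow> (nat \<times> 'c) set" where
  "introduced k L \<Sigma> = {(i, A). i \<in> {1..k} \<and> (A \<in> L i \<or> TypSym i A \<in> \<Sigma>)}"

definition fresh_names ::
  "nat \<Rightarrow> (nat \<Rightarrow> 'c set) \<Rightarrow> ('c, 'r) symbol set \<Rightarrow> (nat \<Rightarrow> 'c \<Rightarrow> 'c) \<Rightarrow> (nat \<Rightarrow> 'r) \<Rightarrow> bool" where
  "fresh_names k L \<Sigma> st rr \<longleftrightarrow>
     inj_on (\<lambda>(i, A). st i A) (introduced k L \<Sigma>) \<and>
     (\<forall>(i, A)\<in>introduced k L \<Sigma>. PC (st i A) \<notin> alc_part \<Sigma>) \<and>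
     inj_on rr {1..k} \<and>
     (\<forall>i\<in>{1..k}. PR (rr i) \<notin> alc_part \<Sigma>)"

fun bar :: "(nat \<Rightarrow> 'c \<Rightarrow> 'c) \<Rightarrow> ('c, 'r) econcept \<Rightarrow> ('c, 'r) concept" where
  "bar st (Classical C) = C"
| "bar st (Typ i A) = Conj (Atom A) (Neg (Atom (st i A)))"
| "bar st (ENeg C) = Neg (bar st C)"
| "bar st (EConj C D) = Conj (bar st C) (bar st D)"

text \<open>The right-hand side \<open>D\<close> of an inclusion is classical, hence equal to its
  translation.\<close>

fun bar_tinclusion ::
  "(nat \<Rightarrow> 'c \<Rightarrow> 'c) \<Rightarrow> ('c, 'r) tinclusion \<Rightarrow> ('c, 'r) concept \<times> ('c, 'r) concept" where
  "bar_tinclusion st (Incl C D) = (bar st (Classical C), bar st (Classical D))"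
| "bar_tinclusion st (TypIncl i A D) = (bar st (Typ i A), bar st (Classical D))"

fun bar_assertion ::
  "(nat \<Rightarrow> 'c \<Rightarrow> 'c) \<Rightarrow> (('c, 'r) econcept, 'r, 'n) assertion \<Rightarrow>
    (('c, 'r) concept, 'r, 'n) assertion" where
  "bar_assertion st (ConceptAssn C a) = ConceptAssn (bar st C) a"
| "bar_assertion st (RoleAssn r a b) = RoleAssn r a b"

definition star_axioms ::
  "(nat \<Rightarrow> 'c \<Rightarrow> 'c) \<Rightarrow> (nat \<Rightarrow> 'r) \<Rightarrow> nat \<Rightarrow> 'c \<Rightarrow>
    (('c, 'r) concept \<times> ('c, 'r) concept) set" where
  "star_axioms st rr i A =
    {(Atom (st i A), Exist (rr i) (Conj (Atom A) (Neg (Atom (st i A))))),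
     (Exist (rr i) (Conj (Atom A) (Neg (Atom (st i A)))), Atom (st i A)),
     (Exist (rr i) (Atom (st i A)), Atom (st i A))}"

definition translate ::
  "nat \<Rightarrow> (nat \<Rightarrow> 'c set) \<Rightarrow> ('c, 'r) symbol set \<Rightarrow> (nat \<Rightarrow> 'c \<Rightarrow> 'c) \<Rightarrow> (nat \<Rightarrow> 'r) \<Rightarrow>
    ('c, 'r, 'n) tkb \<Rightarrow> ('c, 'r, 'n) alc_kb" where
  "translate k L \<Sigma> st rr K =
    (bar_tinclusion st ` fst K \<union> (\<Union>(i, A)\<in>introduced k L \<Sigma>. star_axioms st rr i A),
     bar_assertion st ` snd K)"

definition minimized ::
  "nat \<Rightarrow> (nat \<Rightarrow> 'c set) \<Rightarrow> (nat \<Rightarrow> 'c \<Rightarrow> 'c) \<Rightarrow> ('c, 'r) predicate set" where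
  "minimized k L st = {PC (st j A) | j A. j \<in> {1..k} \<and> A \<in> L j}"

definition varying ::
  "nat \<Rightarrow> (nat \<Rightarrow> 'c set) \<Rightarrow> ('c, 'r) symbol set \<Rightarrow> (nat \<Rightarrow> 'c \<Rightarrow> 'c) \<Rightarrow> (nat \<Rightarrow> 'r) \<Rightarrow>
    ('c, 'r) predicate set" where
  "varying k L \<Sigma> st rr = alc_part \<Sigma> \<union>
     {PC (st i A) | i A. (i, A) \<in> introduced k L \<Sigma> \<and>
        PC (st i A) \<notin> (minimized k L st :: ('c, 'r) predicate set)} \<union>
     {PR (rr i) | i. i \<in> {1..k}}"

definition pattern ::
  "nat \<Rightarrow> (nat \<Rightarrow> 'c set) \<Rightarrow> ('c, 'r) symbol set \<Rightarrow> (nat \<Rightarrow> 'c \<Rightarrow> 'c) \<Rightarrow> (nat \<Rightarrow> 'r) \<Rightarrow>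
    ('c, 'r) circ_pattern" where
  "pattern k L \<Sigma> st rr = (minimized k L st, {}, varying k L \<Sigma> st rr)"

definition ext_vocab ::
  "nat \<Rightarrow> (nat \<Rightarrow> 'c set) \<Rightarrow> ('c, 'r) symbol set \<Rightarrow> (nat \<Rightarrow> 'c \<Rightarrow> 'c) \<Rightarrow> (nat \<Rightarrow> 'r) \<Rightarrow>
    ('c, 'r) predicate set" where
  "ext_vocab k L \<Sigma> st rr = alc_part \<Sigma> \<union>
     {PC (st i A) | i A. (i, A) \<in> introduced k L \<Sigma>} \<union> {PR (rr i) | i. i \<in> {1..k}}"

lemma circ_vocab_pattern: "circ_vocab (pattern k L \<Sigma> st rr) = ext_vocab k L \<Sigma> st rr"
  unfolding circ_vocab_def pattern_def varying_def ext_vocab_def minimized_def introduced_def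
  by auto

lemma pattern_disjoint:
  assumes "fresh_names k L \<Sigma> st rr"
  shows "minimized k L st \<inter> varying k L \<Sigma> st rr = {}"
proof -
  have "PC (st j A) \<notin> alc_part \<Sigma>" if "j \<in> {1..k}" "A \<in> L j" for j A
    using assms that unfolding fresh_names_def introduced_def by blast
  then show ?thesis unfolding varying_def minimized_def by auto
qed

text \<open>If the introduced names are fresh, then the unions below have at most one
  member; see the characterization \<open>phi_eq_iff\<close>.\<close>

definition phi ::
  "nat \<Rightarrow> (nat \<Rightarrow> 'c set) \<Rightarrow> ('c, 'r) symbol set \<Rightarrow> (nat \<Rightarrow> 'c \<Rightarrow> 'c) \<Rightarrow> (nat \<Rightarrow> 'r) \<Rightarrow>
    ('d, 'c, 'r, 'n) tinterp \<Rightarrow> ('d, 'c, 'r, 'n) interp" where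
  "phi k L \<Sigma> st rr I = \<lparr>
     Delta = Delta I,
     conc = (\<lambda>X. if PC X \<in> alc_part \<Sigma> then conc I X
       else \<Union>{not_box_not I i A | i A. (i, A) \<in> introduced k L \<Sigma> \<and> st i A = X}),
     role = (\<lambda>s. if PR s \<in> alc_part \<Sigma> then role I s
       else \<Union>{(lt I i)\<inverse> | i. i \<in> {1..k} \<and> rr i = s}),
     ind = ind I\<rparr>"

lemma phi_simps [simp]:
  "Delta (phi k L \<Sigma> st rr I) = Delta I"
  "ind (phi k L \<Sigma> st rr I) = ind I"
  by (simp_all add: phi_def)

lemma phi_old:
  "PC X \<in> alc_part \<Sigma> \<Longrightarrow> conc (phi k L \<Sigma> st rr I) X = conc I X"
  "PR s \<in> alc_part \<Sigma> \<Longrightarrow> role (phi k L \<Sigma> st rr I) s = role I s"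
  by (simp_all add: phi_def)

lemma phi_star:
  assumes "fresh_names k L \<Sigma> st rr" "(i, A) \<in> introduced k L \<Sigma>"
  shows "conc (phi k L \<Sigma> st rr I) (st i A) = not_box_not I i A"
proof -
  have "{not_box_not I j B | j B. (j, B) \<in> introduced k L \<Sigma> \<and> st j B = st i A} = {not_box_not I i A}"
    using assms unfolding fresh_names_def inj_on_def by fastforce
  moreover have "PC (st i A) \<notin> alc_part \<Sigma>"
    using assms unfolding fresh_names_def by blast
  ultimately show ?thesis by (simp add: phi_def)
qed

lemma phi_role:
  assumes "fresh_names k L \<Sigma> st rr" "i \<in> {1..k}"
  shows "role (phi k L \<Sigma> st rr I) (rr i) = (lt I i)\<inverse>"
proof -
  have "{(lt I j)\<inverse> | j. j \<in> {1..k} \<and> rr j = rr i} = {(lt I i)\<inverse>}"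
    using assms unfolding fresh_names_def inj_on_def by blast
  moreover have "PR (rr i) \<notin> alc_part \<Sigma>"
    using assms unfolding fresh_names_def by blast
  ultimately show ?thesis by (simp add: phi_def)
qed

lemma phi_outside:
  "PC X \<notin> ext_vocab k L \<Sigma> st rr \<Longrightarrow> conc (phi k L \<Sigma> st rr I) X = {}"
  "PR s \<notin> ext_vocab k L \<Sigma> st rr \<Longrightarrow> role (phi k L \<Sigma> st rr I) s = {}"
  by (auto simp: phi_def ext_vocab_def)

lemma is_interp_phi:
  assumes "is_tinterp k \<Sigma> I"
  shows "is_interp (ext_vocab k L \<Sigma> st rr) (phi k L \<Sigma> st rr I)"
proof -
  have I: "is_interp (alc_part \<Sigma>) I" and
    lt: "\<And>i. i \<in> {1..k} \<Longrightarrow> lt I i \<subseteq> Delta I \<times> Delta I"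
    using assms by (auto simp: is_tinterp_def)
  have "conc (phi k L \<Sigma> st rr I) X \<subseteq> Delta I" for X
    using I by (auto simp: phi_def is_interp_def not_box_not_def)
  moreover have "role (phi k L \<Sigma> st rr I) s \<subseteq> Delta I \<times> Delta I" for s
    using I lt by (fastforce simp: phi_def is_interp_def split: if_splits)
  ultimately show ?thesis
    using I by (simp add: is_interp_def phi_outside)
qed

lemma phi_eq_iff:
  assumes fresh: "fresh_names k L \<Sigma> st rr" and J: "is_interp (ext_vocab k L \<Sigma> st rr) J"
  shows "phi k L \<Sigma> st rr I = J \<longleftrightarrow>
    Delta J = Delta I \<and>
    (\<forall>X. PC X \<in> alc_part \<Sigma> \<longrightarrow> conc J X = conc I X) \<and>
    (\<forall>s. PR s \<in> alc_part \<Sigma> \<longrightarrow> role J s = role I s) \<and>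
    (\<forall>(i, A)\<in>introduced k L \<Sigma>. conc J (st i A) = not_box_not I i A) \<and>
    (\<forall>i\<in>{1..k}. role J (rr i) = (lt I i)\<inverse>) \<and>
    (\<forall>a. ind J a = ind I a)"
    (is "?p = J \<longleftrightarrow> ?R")
proof
  show "?p = J \<Longrightarrow> ?R"
    by (auto simp: phi_old phi_star[OF fresh] phi_role[OF fresh])
next
  assume R: ?R
  have "conc ?p X = conc J X" for X
  proof (cases "PC X \<in> ext_vocab k L \<Sigma> st rr")
    case True
    then show ?thesis
      using R unfolding ext_vocab_def by (auto simp: phi_old phi_star[OF fresh])
  next
    case False
    then show ?thesis using J by (simp add: phi_outside is_interp_def)
  qed
  moreover have "role ?p s = role J s" for s
  proof (cases "PR s \<in> ext_vocab k L \<Sigma> st rr")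
    case True
    then show ?thesis
      using R unfolding ext_vocab_def by (auto simp: phi_old phi_role[OF fresh])
  next
    case False
    then show ?thesis using J by (simp add: phi_outside is_interp_def)
  qed
  ultimately show "?p = J"
    using R by (intro interp.equality) (auto intro!: ext)
qed

lemma inj_on_phi:
  fixes \<Sigma> :: "('c, 'r) symbol set"
  assumes fresh: "fresh_names k L \<Sigma> st rr"
  shows "inj_on (phi k L \<Sigma> st rr) {I :: ('d, 'c, 'r, 'n) tinterp. is_tinterp k \<Sigma> I}"
proof (rule inj_onI, clarify)
  fix I I' :: "('d, 'c, 'r, 'n) tinterp"
  assume I: "is_tinterp k \<Sigma> I" and I': "is_tinterp k \<Sigma> I'"
    and eq: "phi k L \<Sigma> st rr I = phi k L \<Sigma> st rr I'"
  have "conc I X = conc I' X" for X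
  proof (cases "PC X \<in> alc_part \<Sigma>")
    case True
    then show ?thesis using eq phi_old(1) by metis
  next
    case False
    then show ?thesis using I I' by (simp add: is_tinterp_def is_interp_def)
  qed
  moreover have "role I s = role I' s" for s
  proof (cases "PR s \<in> alc_part \<Sigma>")
    case True
    then show ?thesis using eq phi_old(2) by metis
  next
    case False
    then show ?thesis using I I' by (simp add: is_tinterp_def is_interp_def)
  qed
  moreover have "lt I i = lt I' i" for i
  proof (cases "i \<in> {1..k}")
    case True
    then show ?thesis using eq phi_role[OF fresh] by (metis converse_converse)
  next
    case False
    then show ?thesis using I I' by (simp add: is_tinterp_def)
  qed
  moreover have "Delta I = Delta I'" "ind I = ind I'"
    using eq phi_simps by metis+
  ultimately show "I = I'"
    by (intro tinterp.equality) (auto intro!: ext)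
qed

definition phi_inv ::
  "nat \<Rightarrow> (nat \<Rightarrow> 'c set) \<Rightarrow> ('c, 'r) symbol set \<Rightarrow> (nat \<Rightarrow> 'c \<Rightarrow> 'c) \<Rightarrow> (nat \<Rightarrow> 'r) \<Rightarrow>
    ('d, 'c, 'r, 'n) interp \<Rightarrow> ('d, 'c, 'r, 'n) tinterp" where
  "phi_inv k L \<Sigma> st rr = inv_into {I. is_tinterp k \<Sigma> I} (phi k L \<Sigma> st rr)"

end

theory Submission
  imports Defs
begin

text \<open>
  The translated knowledge base does not force \<open>r\<^sub>i\<inverse>\<close> to be a smooth strict order, so a model
  of it below \<open>\<phi>(I)\<close> need not lie in the image of \<open>\<phi>\<close>. It can, however, be repaired without
  touching the starred concepts. For \<open>x\<close> in such a model put \<open>S(x) = {A. x \<in> A\<^sub>i\<^sup>*}\<close> and let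
  \<open>y <\<^sub>i x\<close> iff \<open>S(y) \<subset> S(x)\<close> and every introduced \<open>A\<close> that holds at \<open>y\<close> is in \<open>S(x)\<close>.
  This is a strict order, well-founded because the sets \<open>S(x)\<close> are finite, hence smooth; the axioms
  for \<open>A\<^sub>i\<^sup>*\<close> yield that \<open>\<not>\<box>\<^sub>i\<not>A\<close> has the extension \<open>A\<^sub>i\<^sup>*\<close>. So all models of
  the translation, up to their roles \<open>r\<^sub>i\<close>, come from typicality models, and the two preference
  relations coincide.
\<close>

section \<open>Smoothness of well-founded strict orders\<close>

text \<open>If \<open>x\<close> is not minimal in \<open>S\<close>, well-foundedness yields a
  minimal element among the predecessors of \<open>x\<close> in \<open>S\<close>. By transitivity
  anything below it is again a predecessor of \<open>x\<close>, so it is minimal in all of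
  \<open>S\<close>.\<close>

lemma smooth_on_if_wf:
  fixes R :: "('d \<times> 'd) set"
  assumes "wf R" "trans R"
  shows "smooth_on D R"
  unfolding smooth_on_def
proof (intro allI impI ballI)
  fix S :: "'d set" and x assume "x \<in> S"
  show "x \<in> min_elems R S \<or> (\<exists>y\<in>min_elems R S. (y, x) \<in> R)"
  proof (cases "x \<in> min_elems R S")
    case False
    then obtain z where z: "z \<in> {y \<in> S. (y, x) \<in> R}"
      using \<open>x \<in> S\<close> by (auto simp: min_elems_def)
    obtain y where y: "y \<in> {y \<in> S. (y, x) \<in> R}"
      and min: "\<And>z. (z, y) \<in> R \<Longrightarrow> z \<notin> {y \<in> S. (y, x) \<in> R}"
      using assms(1)[unfolded wf_eq_minimal, rule_format, OF z] by blast
    have "y \<in> min_elems R S"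
      using y min transD[OF assms(2)] unfolding min_elems_def by blast
    with y show ?thesis by blast
  qed simp
qed

section \<open>Satisfaction in matching interpretations\<close>

text \<open>The description of \<open>phi\<close> in \<open>phi_eq_iff\<close> without its clause on
  the roles \<open>rr i\<close>. A \<open>J\<close> whose roles \<open>rr i\<close> are arbitrary
  can thus still be paired with a typicality interpretation.\<close>

definition matches ::
  "nat \<Rightarrow> (nat \<Rightarrow> 'c set) \<Rightarrow> ('c, 'r) symbol set \<Rightarrow> (nat \<Rightarrow> 'c \<Rightarrow> 'c) \<Rightarrow>
    ('d, 'c, 'r, 'n) tinterp \<Rightarrow> ('d, 'c, 'r, 'n) interp \<Rightarrow> bool" where
  "matches k L \<Sigma> st I J \<longleftrightarrow> Delta J = Delta I \<and> ind J = ind I \<and>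
     (\<forall>X. PC X \<in> alc_part \<Sigma> \<longrightarrow> conc J X = conc I X) \<and>
     (\<forall>s. PR s \<in> alc_part \<Sigma> \<longrightarrow> role J s = role I s) \<and>
     (\<forall>(i, A)\<in>introduced k L \<Sigma>. conc J (st i A) = not_box_not I i A)"

definition sat_stars ::
  "nat \<Rightarrow> (nat \<Rightarrow> 'c set) \<Rightarrow> ('c, 'r) symbol set \<Rightarrow> (nat \<Rightarrow> 'c \<Rightarrow> 'c) \<Rightarrow> (nat \<Rightarrow> 'r) \<Rightarrow>
    ('d, 'c, 'r, 'n) interp \<Rightarrow> bool" where
  "sat_stars k L \<Sigma> st rr J \<longleftrightarrow>
     (\<forall>(i, A)\<in>introduced k L \<Sigma>. \<forall>(C, D)\<in>star_axioms st rr i A. sem J C \<subseteq> sem J D)"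

lemma matches_phi:
  "fresh_names k L \<Sigma> st rr \<Longrightarrow> matches k L \<Sigma> st I (phi k L \<Sigma> st rr I)"
  by (auto simp: matches_def phi_old phi_star)

lemma introduced_atom:
  assumes "is_signature k L \<Sigma>" "(i, A) \<in> introduced k L \<Sigma>"
  shows "PC A \<in> alc_part \<Sigma>"
  using assms unfolding is_signature_def introduced_def alc_part_def by auto

text \<open>Bounds the sets \<open>S(x)\<close>, on whose cardinality the well-foundedness of the
  repaired order rests.\<close>

lemma finite_introduced:
  assumes "is_signature k L \<Sigma>"
  shows "finite {A. (i, A) \<in> introduced k L \<Sigma>}"
proof -
  have "(\<lambda>A. Pred (PC A)) ` {A. (i, A) \<in> introduced k L \<Sigma>} \<subseteq> \<Sigma>"
    using introduced_atom[OF assms] by (auto simp: alc_part_def)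
  moreover have "finite \<Sigma>"
    using assms by (simp add: is_signature_def)
  moreover have "inj_on (\<lambda>A. Pred (PC A)) {A. (i, A) \<in> introduced k L \<Sigma>}"
    by (simp add: inj_on_def)
  ultimately show ?thesis
    using inj_on_finite by blast
qed

lemma sem_matches:
  assumes "matches k L \<Sigma> st I J" "sig_concept C \<subseteq> \<Sigma>"
  shows "sem J C = sem I C"
  using assms(2) by (induction C) (use assms(1) in \<open>auto simp: matches_def alc_part_def\<close>)

text \<open>Justifies the translation of \<open>Typ i A\<close>: an element of \<open>A\<close> is
  minimal exactly if nothing below it is in \<open>A\<close>, that is, if it avoids the set that
  interprets \<open>st i A\<close>.\<close>

lemma min_elems_not_box_not:
  assumes "conc I A \<subseteq> Delta I"
  shows "min_elems (lt I i) (conc I A) = conc I A \<inter> (Delta I - not_box_not I i A)"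
  using assms by (auto simp: min_elems_def not_box_not_def)

lemma sem_bar:
  assumes "matches k L \<Sigma> st I J" "is_signature k L \<Sigma>" "is_tinterp k \<Sigma> I"
    and "sig_econcept C \<subseteq> \<Sigma>"
  shows "sem J (bar st C) = esem I C"
  using assms(4)
proof (induction C)
  case (Classical C)
  then show ?case using sem_matches[OF assms(1)] by simp
next
  case (Typ i A)
  then have "(i, A) \<in> introduced k L \<Sigma>" "PC A \<in> alc_part \<Sigma>"
    using assms(2) by (auto simp: is_signature_def introduced_def alc_part_def)
  moreover have "conc I A \<subseteq> Delta I"
    using assms(3) by (auto simp: is_tinterp_def is_interp_def)
  ultimately show ?case
    using assms(1) by (auto simp: matches_def min_elems_not_box_not)
next
  case (ENeg C)
  then show ?case using assms(1) by (auto simp: matches_def)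
next
  case (EConj C D)
  then show ?case by simp
qed

lemma sat_bar_tinclusion:
  assumes "matches k L \<Sigma> st I J" "is_signature k L \<Sigma>" "is_tinterp k \<Sigma> I"
    and "sig_tinclusion ax \<subseteq> \<Sigma>"
  shows "(case bar_tinclusion st ax of (C, D) \<Rightarrow> sem J C \<subseteq> sem J D) \<longleftrightarrow> sat_tinclusion I ax"
proof (cases ax)
  case (Incl C D)
  then show ?thesis using assms(4) sem_matches[OF assms(1)] by simp
next
  case (TypIncl i A D)
  then have "sig_econcept (Typ i A) \<subseteq> \<Sigma>" "sig_concept D \<subseteq> \<Sigma>"
    using assms(4) by auto
  then show ?thesis
    using TypIncl sem_matches[OF assms(1)] sem_bar[OF assms(1-3), of "Typ i A"] by simp
qed

lemma sat_bar_assertion: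
  assumes "matches k L \<Sigma> st I J" "is_signature k L \<Sigma>" "is_tinterp k \<Sigma> I"
    and "sig_assertion as \<subseteq> \<Sigma>"
  shows "sat_assertion J (bar_assertion st as) \<longleftrightarrow> sat_tassertion I as"
proof (cases as)
  case (ConceptAssn C a)
  then show ?thesis using assms(1,4) sem_bar[OF assms(1-3)] by (simp add: matches_def)
next
  case (RoleAssn r a b)
  then show ?thesis using assms(1,4) by (simp add: matches_def alc_part_def)
qed

text \<open>The axioms stemming from \<open>K\<close> use only symbols on which matching
  interpretations agree. The star axioms also speak of the roles \<open>rr i\<close>, about which
  matching says nothing, so they remain as a separate conjunct.\<close>

lemma alc_model_translate_iff:
  assumes "matches k L \<Sigma> st I J" "is_signature k L \<Sigma>" "is_tinterp k \<Sigma> I" "sig K \<subseteq> \<Sigma>"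
    and "is_interp P J"
  shows "alc_model P (translate k L \<Sigma> st rr K) J \<longleftrightarrow> tmodel k \<Sigma> K I \<and> sat_stars k L \<Sigma> st rr J"
proof -
  have "(\<forall>(C, D)\<in>bar_tinclusion st ` fst K. sem J C \<subseteq> sem J D) \<longleftrightarrow>
      (\<forall>ax\<in>fst K. sat_tinclusion I ax)"
    unfolding ball_simps
    by (rule ball_cong[OF refl], rule sat_bar_tinclusion[OF assms(1-3)])
      (use assms(4) in \<open>auto simp: sig_def\<close>)
  moreover have "(\<forall>as\<in>bar_assertion st ` snd K. sat_assertion J as) \<longleftrightarrow>
      (\<forall>as\<in>snd K. sat_tassertion I as)"
    unfolding ball_simps
    by (rule ball_cong[OF refl], rule sat_bar_assertion[OF assms(1-3)])
      (use assms(4) in \<open>auto simp: sig_def\<close>)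
  ultimately show ?thesis
    using assms(3,5) unfolding alc_model_def tmodel_def translate_def sat_stars_def
    by (simp add: ball_Un) blast
qed

lemma sat_stars_phi:
  assumes "is_signature k L \<Sigma>" "fresh_names k L \<Sigma> st rr" "is_tinterp k \<Sigma> I"
  shows "sat_stars k L \<Sigma> st rr (phi k L \<Sigma> st rr I)"
  unfolding sat_stars_def
proof clarify
  fix i A C D x
  assume iA: "(i, A) \<in> introduced k L \<Sigma>" and ax: "(C, D) \<in> star_axioms st rr i A"
    and x: "x \<in> sem (phi k L \<Sigma> st rr I) C"
  let ?J = "phi k L \<Sigma> st rr I"
  have i: "i \<in> {1..k}" using iA by (simp add: introduced_def)
  note J = phi_old(1)[OF introduced_atom[OF assms(1) iA]] phi_star[OF assms(2) iA]
    phi_role[OF assms(2) i]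
  have I: "trans (lt I i)" "smooth_on (Delta I) (lt I i)" "conc I A \<subseteq> Delta I"
    using assms(3) i by (auto simp: is_tinterp_def is_interp_def)
  \<comment> \<open>Smoothness enters here, for the inclusion of \<open>st i A\<close> in the
    existential concept: under an element of \<open>A\<close> below \<open>x\<close> there is a
    minimal one, and transitivity places it below \<open>x\<close>.\<close>
  have minimal: "\<exists>y. (y, x) \<in> lt I i \<and> y \<in> conc I A \<and> y \<in> Delta I \<and> y \<notin> not_box_not I i A"
    if "x \<in> not_box_not I i A"
  proof -
    obtain z where z: "(z, x) \<in> lt I i" "z \<in> conc I A"
      using \<open>x \<in> not_box_not I i A\<close> by (auto simp: not_box_not_def)
    then obtain y where "y \<in> min_elems (lt I i) (conc I A)" "y = z \<or> (y, z) \<in> lt I i"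
      using I(2)[unfolded smooth_on_def, rule_format, OF I(3) z(2)] by blast
    then show ?thesis
      using z(1) I(1) I(3) by (auto simp: min_elems_not_box_not dest: transD)
  qed
  consider "C = Atom (st i A)" "D = Exist (rr i) (Conj (Atom A) (Neg (Atom (st i A))))"
    | "C = Exist (rr i) (Conj (Atom A) (Neg (Atom (st i A))))" "D = Atom (st i A)"
    | "C = Exist (rr i) (Atom (st i A))" "D = Atom (st i A)"
    using ax by (auto simp: star_axioms_def)
  then show "x \<in> sem ?J D"
  proof cases
    case 1
    then show ?thesis using x minimal by (auto simp: J not_box_not_def)
  next
    case 2
    then show ?thesis using x by (auto simp: J not_box_not_def)
  next
    case 3
    then show ?thesis using x I(1) by (auto simp: J not_box_not_def dest: transD)
  qed
qed

lemma tmodel_iff_alc_model_phi: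
  assumes "is_signature k L \<Sigma>" "fresh_names k L \<Sigma> st rr" "sig K \<subseteq> \<Sigma>" "is_tinterp k \<Sigma> I"
  shows "tmodel k \<Sigma> K I \<longleftrightarrow>
    alc_model (ext_vocab k L \<Sigma> st rr) (translate k L \<Sigma> st rr K) (phi k L \<Sigma> st rr I)"
  using alc_model_translate_iff[OF matches_phi[OF assms(2)] assms(1,4,3) is_interp_phi[OF assms(4)]]
    sat_stars_phi[OF assms(1,2,4)] by simp

section \<open>The two preference relations\<close>

text \<open>For \<open>A\<close> in \<open>L i\<close>, the pair \<open>(x, A)\<close> is in
  \<open>box_minus L I i\<close> exactly if \<open>x\<close> is in \<open>st i A\<close> under
  \<open>J\<close>. As no predicate is fixed, both relations compare the same sets.\<close>

lemma preferred_iff_circ_less: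
  fixes \<Sigma> :: "('c, 'r) symbol set"
  assumes I: "matches k L \<Sigma> st I J" and I': "matches k L \<Sigma> st I' J'"
  shows "preferred k L I' I \<longleftrightarrow> circ_less (pattern k L \<Sigma> st rr) J' J"
proof -
  have star: "conc J (st i A) = not_box_not I i A" "conc J' (st i A) = not_box_not I' i A"
    if "i \<in> {1..k}" "A \<in> L i" for i A
    using I I' that by (auto simp: matches_def introduced_def)
  have le: "(\<forall>i\<in>{1..k}. box_minus L I' i \<subseteq> box_minus L I i) \<longleftrightarrow>
      (\<forall>p\<in>(minimized k L st :: ('c, 'r) predicate set). pred_sub J' J p)"
    using star by (fastforce simp: minimized_def box_minus_def)
  have ge: "(\<forall>i\<in>{1..k}. box_minus L I i \<subseteq> box_minus L I' i) \<longleftrightarrow>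
      (\<forall>p\<in>(minimized k L st :: ('c, 'r) predicate set). pred_sub J J' p)"
    using star by (fastforce simp: minimized_def box_minus_def)
  \<comment> \<open>Given all inclusions, strictness somewhere means that some reverse inclusion
    fails, so \<open>le\<close> and \<open>ge\<close> determine both relations.\<close>
  have "preferred k L I' I \<longleftrightarrow> Delta I' = Delta I \<and> ind I' = ind I \<and>
      (\<forall>i\<in>{1..k}. box_minus L I' i \<subseteq> box_minus L I i) \<and>
      \<not> (\<forall>i\<in>{1..k}. box_minus L I i \<subseteq> box_minus L I' i)"
    unfolding preferred_def by blast
  also have "\<dots> \<longleftrightarrow> circ_less (pattern k L \<Sigma> st rr) J' J"
    unfolding le ge using I I' by (auto simp: circ_less_def pattern_def matches_def)
  finally show ?thesis .
qed

section \<open>Typicality interpretations from models of the translation\<close>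

text \<open>The orders are a parameter because two choices occur: the repaired orders and the
  converses of the roles \<open>rr i\<close>. Emptying everything outside the vocabulary yields the
  canonical representative.\<close>

definition typ_reduct ::
  "nat \<Rightarrow> ('c, 'r) symbol set \<Rightarrow> ('d, 'c, 'r, 'n) interp \<Rightarrow> (nat \<Rightarrow> ('d \<times> 'd) set) \<Rightarrow>
    ('d, 'c, 'r, 'n) tinterp" where
  "typ_reduct k \<Sigma> J R = \<lparr>
     Delta = Delta J,
     conc = (\<lambda>X. if PC X \<in> alc_part \<Sigma> then conc J X else {}),
     role = (\<lambda>s. if PR s \<in> alc_part \<Sigma> then role J s else {}),
     ind = ind J,
     lt = (\<lambda>i. if i \<in> {1..k} then R i else {})\<rparr>"

lemma is_tinterp_typ_reduct:
  assumes "is_interp P J"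
    and "\<And>i. i \<in> {1..k} \<Longrightarrow> R i \<subseteq> Delta J \<times> Delta J \<and> irrefl (R i) \<and> trans (R i) \<and>
      smooth_on (Delta J) (R i)"
  shows "is_tinterp k \<Sigma> (typ_reduct k \<Sigma> J R)"
  using assms by (auto simp: is_tinterp_def is_interp_def typ_reduct_def)

lemma matches_typ_reduct:
  assumes "is_signature k L \<Sigma>"
    and "\<And>i A. (i, A) \<in> introduced k L \<Sigma> \<Longrightarrow>
      conc J (st i A) = {x \<in> Delta J. \<exists>y. (y, x) \<in> R i \<and> y \<in> conc J A}"
  shows "matches k L \<Sigma> st (typ_reduct k \<Sigma> J R) J"
proof -
  have "not_box_not (typ_reduct k \<Sigma> J R) i A =
      {x \<in> Delta J. \<exists>y. (y, x) \<in> R i \<and> y \<in> conc J A}" if "(i, A) \<in> introduced k L \<Sigma>" for i A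
    using that introduced_atom[OF assms(1) that]
    by (auto simp: not_box_not_def typ_reduct_def introduced_def)
  then show ?thesis
    using assms(2) by (auto simp: matches_def typ_reduct_def)
qed

text \<open>The second fact covers every \<open>y\<close> in \<open>A\<close>: if \<open>y\<close>
  is in \<open>st i A\<close>, the propagation axiom applies, otherwise the equivalence
  does.\<close>

lemma sat_starsD:
  assumes "sat_stars k L \<Sigma> st rr J" "is_interp P J" "(i, A) \<in> introduced k L \<Sigma>"
  shows "x \<in> conc J (st i A) \<Longrightarrow>
      \<exists>y. (x, y) \<in> role J (rr i) \<and> y \<in> conc J A \<and> y \<notin> conc J (st i A)"
    and "(x, y) \<in> role J (rr i) \<Longrightarrow> y \<in> conc J A \<Longrightarrow> x \<in> conc J (st i A)"
    and "(x, y) \<in> role J (rr i) \<Longrightarrow> y \<in> conc J (st i A) \<Longrightarrow> x \<in> conc J (st i A)"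
proof -
  have "\<forall>(C, D)\<in>star_axioms st rr i A. sem J C \<subseteq> sem J D"
    using assms(1,3) unfolding sat_stars_def by blast
  then have ax:
    "conc J (st i A) \<subseteq> {x \<in> Delta J. \<exists>y. (x, y) \<in> role J (rr i) \<and>
        y \<in> conc J A \<inter> (Delta J - conc J (st i A))}"
    "{x \<in> Delta J. \<exists>y. (x, y) \<in> role J (rr i) \<and>
        y \<in> conc J A \<inter> (Delta J - conc J (st i A))} \<subseteq> conc J (st i A)"
    "{x \<in> Delta J. \<exists>y. (x, y) \<in> role J (rr i) \<and> y \<in> conc J (st i A)} \<subseteq> conc J (st i A)"
    by (simp_all add: star_axioms_def)
  have rr: "role J (rr i) \<subseteq> Delta J \<times> Delta J"
    using assms(2) by (simp add: is_interp_def)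
  show "x \<in> conc J (st i A) \<Longrightarrow>
      \<exists>y. (x, y) \<in> role J (rr i) \<and> y \<in> conc J A \<and> y \<notin> conc J (st i A)"
    using ax(1) by blast
  show "(x, y) \<in> role J (rr i) \<Longrightarrow> y \<in> conc J A \<Longrightarrow> x \<in> conc J (st i A)"
    using ax(2,3) rr by blast
  show "(x, y) \<in> role J (rr i) \<Longrightarrow> y \<in> conc J (st i A) \<Longrightarrow> x \<in> conc J (st i A)"
    using ax(3) rr by blast
qed

lemma ex_matching_tinterp:
  assumes sig: "is_signature k L \<Sigma>" and J: "is_interp P J" and stars: "sat_stars k L \<Sigma> st rr J"
  shows "\<exists>I. is_tinterp k \<Sigma> I \<and> matches k L \<Sigma> st I J"
proof -
  define S where "S i x = {A. (i, A) \<in> introduced k L \<Sigma> \<and> x \<in> conc J (st i A)}" for i x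
  define T where "T i x = {A. (i, A) \<in> introduced k L \<Sigma> \<and> x \<in> conc J A}" for i x
  define R where "R i = {(y, x). y \<in> Delta J \<and> x \<in> Delta J \<and> S i y \<subset> S i x \<and> T i y \<subseteq> S i x}"
    for i
  note D = sat_starsD[OF stars J]
  have fin: "finite (S i x)" for i x
    by (rule finite_subset[OF _ finite_introduced[OF sig, of i]]) (auto simp: S_def)
  have "R i \<subseteq> Delta J \<times> Delta J \<and> irrefl (R i) \<and> trans (R i) \<and> smooth_on (Delta J) (R i)" for i
  proof -
    have "R i \<subseteq> measure (\<lambda>x. card (S i x))"
      by (rule subrelI) (simp add: R_def psubset_card_mono[OF fin])
    then have "wf (R i)" by (rule wf_subset[OF wf_measure])
    \<comment> \<open>For \<open>(z, y)\<close> and \<open>(y, x)\<close> in \<open>R i\<close> one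
      has \<open>T i z \<subseteq> S i y \<subset> S i x\<close>.\<close>
    moreover have "trans (R i)"
      unfolding R_def by (rule transI) blast
    ultimately show ?thesis
      using smooth_on_if_wf by (auto simp: R_def irrefl_def)
  qed
  then have "is_tinterp k \<Sigma> (typ_reduct k \<Sigma> J R)"
    using is_tinterp_typ_reduct[OF J] by blast
  moreover have "conc J (st i A) = {x \<in> Delta J. \<exists>y. (y, x) \<in> R i \<and> y \<in> conc J A}"
    if iA: "(i, A) \<in> introduced k L \<Sigma>" for i A
  proof (intro equalityI subsetI)
    \<comment> \<open>The role successor \<open>y\<close> of \<open>x\<close> given by the
      equivalence is the witness: the axioms carry \<open>S i y\<close> and \<open>T i y\<close>
      into \<open>S i x\<close>, and \<open>A\<close> itself makes the first inclusion
      strict.\<close>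
    fix x assume x: "x \<in> conc J (st i A)"
    then obtain y where y: "(x, y) \<in> role J (rr i)" "y \<in> conc J A" "y \<notin> conc J (st i A)"
      using D(1)[OF iA] by blast
    have "x \<in> Delta J" "y \<in> Delta J"
      using J y(1) by (auto simp: is_interp_def)
    moreover have "S i y \<subseteq> S i x"
      using D(3) y(1) by (auto simp: S_def)
    moreover have "A \<in> S i x - S i y"
      using x y(3) iA by (simp add: S_def)
    moreover have "T i y \<subseteq> S i x"
      using D(2) y(1) by (auto simp: S_def T_def)
    ultimately have "(y, x) \<in> R i" by (auto simp: R_def)
    then show "x \<in> {x \<in> Delta J. \<exists>y. (y, x) \<in> R i \<and> y \<in> conc J A}"
      using \<open>x \<in> Delta J\<close> y(2) by blast
  next
    \<comment> \<open>Here \<open>A\<close> is in \<open>T i y\<close>, hence in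
      \<open>S i x\<close>.\<close>
    fix x assume "x \<in> {x \<in> Delta J. \<exists>y. (y, x) \<in> R i \<and> y \<in> conc J A}"
    then show "x \<in> conc J (st i A)"
      using iA by (auto simp: R_def S_def T_def)
  qed
  ultimately show ?thesis
    using matches_typ_reduct[OF sig] by blast
qed

lemma sat_stars_if_alc_model:
  "alc_model P (translate k L \<Sigma> st rr K) J \<Longrightarrow> sat_stars k L \<Sigma> st rr J"
  unfolding alc_model_def translate_def sat_stars_def by auto

section \<open>Minimal models and circumscription\<close>

lemma minimal_model_iff_circ_model_phi:
  assumes "is_signature k L \<Sigma>" "fresh_names k L \<Sigma> st rr" "sig K \<subseteq> \<Sigma>" "is_tinterp k \<Sigma> I"
  shows "minimal_model k L \<Sigma> K I \<longleftrightarrow>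
    circ_model (pattern k L \<Sigma> st rr) (translate k L \<Sigma> st rr K) (phi k L \<Sigma> st rr I)"
proof -
  let ?J = "phi k L \<Sigma> st rr I" and ?K' = "translate k L \<Sigma> st rr K"
  have "(\<exists>I'. tmodel k \<Sigma> K I' \<and> preferred k L I' I) \<longleftrightarrow>
      (\<exists>J'. alc_model (ext_vocab k L \<Sigma> st rr) ?K' J' \<and> circ_less (pattern k L \<Sigma> st rr) J' ?J)"
    (is "?l \<longleftrightarrow> ?r")
  proof
    assume ?l
    then obtain I' where I': "tmodel k \<Sigma> K I'" "preferred k L I' I" by blast
    then have "alc_model (ext_vocab k L \<Sigma> st rr) ?K' (phi k L \<Sigma> st rr I')"
      using tmodel_iff_alc_model_phi[OF assms(1-3)] by (auto simp: tmodel_def)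
    then show ?r
      using preferred_iff_circ_less[OF matches_phi[OF assms(2)] matches_phi[OF assms(2)]] I'(2)
      by blast
  next
    assume ?r
    then obtain J' where J': "alc_model (ext_vocab k L \<Sigma> st rr) ?K' J'"
      "circ_less (pattern k L \<Sigma> st rr) J' ?J" by blast
    then have int: "is_interp (ext_vocab k L \<Sigma> st rr) J'" by (simp add: alc_model_def)
    \<comment> \<open>\<open>J'\<close> may lie outside the image of \<open>phi\<close>. The repair
      provides \<open>I'\<close> with the same starred concepts, and these alone decide the
      preference once domain and individuals agree.\<close>
    obtain I' where I': "is_tinterp k \<Sigma> I'" "matches k L \<Sigma> st I' J'"
      using ex_matching_tinterp[OF assms(1) int sat_stars_if_alc_model[OF J'(1)]] by blast
    have "tmodel k \<Sigma> K I'"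
      using alc_model_translate_iff[OF I'(2) assms(1) I'(1) assms(3) int] J'(1) by blast
    then show ?l
      using preferred_iff_circ_less[OF matches_phi[OF assms(2)] I'(2)] J'(2) by blast
  qed
  then show ?thesis
    using tmodel_iff_alc_model_phi[OF assms]
    by (simp add: minimal_model_def circ_model_def circ_vocab_pattern)
qed

text \<open>No repair is made here: the converse of \<open>rr i\<close> is itself taken as the
  order. The star axioms then give \<open>st i A\<close> the same extension as
  \<open>Exist (rr i) (Atom A)\<close>, which is what \<open>phi\<close> prescribes.\<close>

lemma alc_model_in_range_phi:
  assumes sig: "is_signature k L \<Sigma>" and fresh: "fresh_names k L \<Sigma> st rr"
    and model: "alc_model (ext_vocab k L \<Sigma> st rr) (translate k L \<Sigma> st rr K) J"
    and order: "\<forall>i\<in>{1..k}. irrefl ((role J (rr i))\<inverse>) \<and> trans ((role J (rr i))\<inverse>) \<and>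
      smooth_on (Delta J) ((role J (rr i))\<inverse>)"
  shows "J \<in> phi k L \<Sigma> st rr ` {I. is_tinterp k \<Sigma> I}"
proof -
  let ?I = "typ_reduct k \<Sigma> J (\<lambda>i. (role J (rr i))\<inverse>)"
  have J: "is_interp (ext_vocab k L \<Sigma> st rr) J" using model by (simp add: alc_model_def)
  then have "is_tinterp k \<Sigma> ?I"
    using order by (intro is_tinterp_typ_reduct) (auto simp: is_interp_def)
  moreover have "matches k L \<Sigma> st ?I J"
  proof (rule matches_typ_reduct[OF sig])
    fix i A assume iA: "(i, A) \<in> introduced k L \<Sigma>"
    note D = sat_starsD[OF sat_stars_if_alc_model[OF model] J iA]
    have "conc J (st i A) \<subseteq> Delta J" "role J (rr i) \<subseteq> Delta J \<times> Delta J"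
      using J by (auto simp: is_interp_def)
    then show "conc J (st i A) = {x \<in> Delta J. \<exists>y. (y, x) \<in> (role J (rr i))\<inverse> \<and> y \<in> conc J A}"
      using D(1,2) by blast
  qed
  then have "phi k L \<Sigma> st rr ?I = J"
    unfolding phi_eq_iff[OF fresh J] by (auto simp: matches_def typ_reduct_def)
  ultimately show ?thesis by (intro image_eqI[OF sym]) auto
qed

theorem lemma18:
  fixes K :: "('c::countable, 'r::countable, 'n::countable) tkb"
    and k :: nat
    and L :: "nat \<Rightarrow> 'c set"
    and \<Sigma> :: "('c, 'r) symbol set"
    and st :: "nat \<Rightarrow> 'c \<Rightarrow> 'c"
    and rr :: "nat \<Rightarrow> 'r"
    and I :: "('d, 'c, 'r, 'n) tinterp"
    and J :: "('d, 'c, 'r, 'n) interp"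
  assumes "is_tkb k K"
    and "\<forall>i\<in>{1..k}. finite (L i)"
    and "is_signature k L \<Sigma>"
    and "sig K \<subseteq> \<Sigma>"
    and "fresh_names k L \<Sigma> st rr"
    and "is_tinterp k \<Sigma> I"
    and "is_interp (ext_vocab k L \<Sigma> st rr) J"
    and "\<forall>i\<in>{1..k}. irrefl ((role J (rr i))\<inverse>) \<and> trans ((role J (rr i))\<inverse>) \<and>
           smooth_on (Delta J) ((role J (rr i))\<inverse>)"
  shows "(minimal_model k L \<Sigma> K I \<longleftrightarrow>
           circ_model (pattern k L \<Sigma> st rr) (translate k L \<Sigma> st rr K) (phi k L \<Sigma> st rr I)) \<and>
         (circ_model (pattern k L \<Sigma> st rr) (translate k L \<Sigma> st rr K) J \<longleftrightarrow>
           J \<in> phi k L \<Sigma> st rr ` {I'. is_tinterp k \<Sigma> I'} \<and>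
           minimal_model k L \<Sigma> K (phi_inv k L \<Sigma> st rr J))"
proof -
  note ctx = \<open>is_signature k L \<Sigma>\<close> \<open>fresh_names k L \<Sigma> st rr\<close>
  note a = minimal_model_iff_circ_model_phi[OF ctx \<open>sig K \<subseteq> \<Sigma>\<close>]
  have inv: "is_tinterp k \<Sigma> (phi_inv k L \<Sigma> st rr J) \<and>
      phi k L \<Sigma> st rr (phi_inv k L \<Sigma> st rr J) = J"
    if "J \<in> phi k L \<Sigma> st rr ` {I'. is_tinterp k \<Sigma> I'}"
    using inv_into_into[OF that] f_inv_into_f[OF that] by (simp add: phi_inv_def)
  \<comment> \<open>With \<open>J\<close> known to be in the image, the second equivalence is the
    first one applied to \<open>phi_inv k L \<Sigma> st rr J\<close>.\<close>
  have "J \<in> phi k L \<Sigma> st rr ` {I'. is_tinterp k \<Sigma> I'}"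
    if "circ_model (pattern k L \<Sigma> st rr) (translate k L \<Sigma> st rr K) J"
    using alc_model_in_range_phi[OF ctx _ assms(8)] that
    unfolding circ_model_def circ_vocab_pattern by blast
  then show ?thesis
    using a[OF \<open>is_tinterp k \<Sigma> I\<close>] a[of "phi_inv k L \<Sigma> st rr J"] inv by metis
qed

end
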